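(* Let $X \in \mathbb{R}^{n\times p}$ be a fixed (nonrandom) matrix with $\operatorname{rank}(X)=p$, let $D\in\mathbb{R}^{m\times p}$ be an arbitrary matrix, and let $y\sim N(\mu,\sigma^2 I)$ in $\mathbb{R}^n$ with $\sigma>0$. Fix $\lambda\ge 0$ and let $\hat\beta_\lambda=\hat\beta_\lambda(y)$ be the solution of the generalized lasso problem $$\min_{\beta\in\mathbb{R}^p}\ \tfrac12\|y-X\beta\|_2^2+\lambda\|D\beta\|_1 .$$ Then the fit $X\hat\beta_\lambda$ has degrees of freedom $$\operatorname{df}(X\hat\beta_\lambda)=\mathrm{E}\big[\operatorname{nullity}(D_{-\mathcal{B}(y)})\big],$$ where $\mathcal{B}(y)$ is the boundary set of a dual solution $\hat u_\lambda(y)$. (Any dual solution at $y$ may be used to construct $\mathcal{B}(y)$: the space $\operatorname{null}(D_{-\mathcal{B}(y)})$ does not depend on this choice for almost every $y$.)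
   Context: Degrees of freedom: for $g:\mathbb{R}^n\to\mathbb{R}^n$ with coordinate functions $g_i$ and $y\sim N(\mu,\sigma^2I)$, $\operatorname{df}(g)=\frac{1}{\sigma^2}\sum_{i=1}^n\operatorname{Cov}(g_i(y),y_i)$; here $g(y)=X\hat\beta_\lambda(y)$. Dual problem: a dual solution $\hat u_\lambda(y)$ is any minimizer over $u\in\mathbb{R}^m$ of $\tfrac12(X^Ty-D^Tu)^T(X^TX)^{+}(X^Ty-D^Tu)$ subject to $\|u\|_\infty\le\lambda$ and $D^Tu\in\operatorname{row}(X)$ (the last constraint is vacuous when $\operatorname{rank}(X)=p$; $^+$ is the Moore–Penrose pseudoinverse). It may not be unique. Boundary set: $\mathcal{B}(y)=\{i\in\{1,\dots,m\}: |\hat u_{\lambda,i}(y)|=\lambda\}$. $D_{-\mathcal{B}}$ is the matrix formed by the rows of $D$ whose indices are not in $\mathcal{B}$ (if there are no such rows, its null space is all of $\mathbb{R}^p$). The nullity of a matrix is the dimension of its null space. *)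

theory Defs
  imports "HOL-Probability.Probability"
begin

text \<open>
  Gaussian vectors and degrees of freedom.  The joint density of \<open>N(\<mu>, \<sigma>\<^sup>2 I)\<close> is the product of
  the coordinate densities; the parameter of \<^const>\<open>normal_density\<close> is the standard deviation.
\<close>

definition isotropic_gaussian :: "'w measure \<Rightarrow> ('w \<Rightarrow> real^'n) \<Rightarrow> real^'n \<Rightarrow> real \<Rightarrow> bool" where
  "isotropic_gaussian M Y \<mu> \<sigma> \<longleftrightarrow>
     distributed M lborel Y (\<lambda>x. ennreal (\<Prod>i\<in>UNIV. normal_density (\<mu> $ i) \<sigma> (x $ i)))"

definition covariance :: "'w measure \<Rightarrow> ('w \<Rightarrow> real) \<Rightarrow> ('w \<Rightarrow> real) \<Rightarrow> real" where
  "covariance M A B =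
     (LINT \<omega>|M. (A \<omega> - (LINT \<omega>'|M. A \<omega>')) * (B \<omega> - (LINT \<omega>'|M. B \<omega>')))"

definition degrees_of_freedom ::
    "'w measure \<Rightarrow> ('w \<Rightarrow> real^'n) \<Rightarrow> real \<Rightarrow> (real^'n \<Rightarrow> real^'n) \<Rightarrow> real" where
  "degrees_of_freedom M Y \<sigma> g =
     1 / \<sigma>\<^sup>2 * (\<Sum>i\<in>UNIV. covariance M (\<lambda>\<omega>. g (Y \<omega>) $ i) (\<lambda>\<omega>. Y \<omega> $ i))"

text \<open>
  \<open>LINT\<close> returns 0 on non-integrable functions; this predicate says that all the covariances in
  \<^const>\<open>degrees_of_freedom\<close> are genuine.
\<close>

definition has_degrees_of_freedom ::
    "'w measure \<Rightarrow> ('w \<Rightarrow> real^'n) \<Rightarrow> (real^'n \<Rightarrow> real^'n) \<Rightarrow> bool" where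
  "has_degrees_of_freedom M Y g \<longleftrightarrow>
     (\<forall>i. integrable M (\<lambda>\<omega>. g (Y \<omega>) $ i) \<and> integrable M (\<lambda>\<omega>. Y \<omega> $ i) \<and>
          integrable M (\<lambda>\<omega>. g (Y \<omega>) $ i * Y \<omega> $ i))"

definition genlasso_objective ::
    "real^'p^'n \<Rightarrow> real^'p^'m \<Rightarrow> real \<Rightarrow> real^'n \<Rightarrow> real^'p \<Rightarrow> real" where
  "genlasso_objective X D l y b =
     1 / 2 * (norm (y - X *v b))\<^sup>2 + l * (\<Sum>i\<in>UNIV. \<bar>(D *v b) $ i\<bar>)"

definition genlasso_solution ::
    "real^'p^'n \<Rightarrow> real^'p^'m \<Rightarrow> real \<Rightarrow> real^'n \<Rightarrow> real^'p \<Rightarrow> bool" where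
  "genlasso_solution X D l y b \<longleftrightarrow> is_arg_min (genlasso_objective X D l y) (\<lambda>_. True) b"

text \<open>The Moore--Penrose pseudoinverse, by the four Penrose conditions.\<close>

definition is_pseudoinverse :: "real^'n^'m \<Rightarrow> real^'m^'n \<Rightarrow> bool" where
  "is_pseudoinverse A G \<longleftrightarrow>
     A ** G ** A = A \<and> G ** A ** G = G \<and>
     transpose (A ** G) = A ** G \<and> transpose (G ** A) = G ** A"

definition pseudoinverse :: "real^'n^'m \<Rightarrow> real^'m^'n" where
  "pseudoinverse A = (THE G. is_pseudoinverse A G)"

lemma is_pseudoinverse_unique:
  assumes "is_pseudoinverse A G" "is_pseudoinverse A H"
  shows "G = H"
proof -
  note P = assms[unfolded is_pseudoinverse_def]
  have AG: "A ** G = A ** H"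
  proof -
    have "A ** G = transpose ((A ** H) ** (A ** G))"
      using P by (metis matrix_mul_assoc)
    also have "\<dots> = (A ** G) ** (A ** H)"
      using P by (metis matrix_transpose_mul)
    also have "\<dots> = A ** H"
      using P by (metis matrix_mul_assoc)
    finally show ?thesis .
  qed
  have GA: "G ** A = H ** A"
  proof -
    have "G ** A = transpose ((G ** A) ** (H ** A))"
      using P by (metis matrix_mul_assoc)
    also have "\<dots> = (H ** A) ** (G ** A)"
      using P by (metis matrix_transpose_mul)
    also have "\<dots> = H ** A"
      using P by (metis matrix_mul_assoc)
    finally show ?thesis .
  qed
  show ?thesis
    using P AG GA by (metis matrix_mul_assoc)
qed

lemma pseudoinverse_eqI: "is_pseudoinverse A G \<Longrightarrow> pseudoinverse A = G"
  unfolding pseudoinverse_def by (blast intro: is_pseudoinverse_unique)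

definition dual_objective :: "real^'p^'n \<Rightarrow> real^'p^'m \<Rightarrow> real^'n \<Rightarrow> real^'m \<Rightarrow> real" where
  "dual_objective X D y u =
     (let r = transpose X *v y - transpose D *v u
      in 1 / 2 * (r \<bullet> (pseudoinverse (transpose X ** X) *v r)))"

definition dual_feasible :: "real^'p^'n \<Rightarrow> real^'p^'m \<Rightarrow> real \<Rightarrow> real^'m \<Rightarrow> bool" where
  "dual_feasible X D l u \<longleftrightarrow> infnorm u \<le> l \<and> transpose D *v u \<in> span (rows X)"

definition dual_solution ::
    "real^'p^'n \<Rightarrow> real^'p^'m \<Rightarrow> real \<Rightarrow> real^'n \<Rightarrow> real^'m \<Rightarrow> bool" where
  "dual_solution X D l y u \<longleftrightarrow> is_arg_min (dual_objective X D y) (dual_feasible X D l) u"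

definition boundary_set :: "real \<Rightarrow> real^'m \<Rightarrow> 'm set" where
  "boundary_set l u = {i. \<bar>u $ i\<bar> = l}"

text \<open>
  The number of rows of \<open>D\<^sub>-\<^sub>B\<close> varies with \<open>B\<close>, so it is not itself an element of a matrix type;
  its null space consists of the vectors annihilated by every row of \<open>D\<close> outside \<open>B\<close>.
\<close>

definition null_space_without :: "real^'p^'m \<Rightarrow> 'm set \<Rightarrow> (real^'p) set" where
  "null_space_without D B = {b. \<forall>i. i \<notin> B \<longrightarrow> row i D \<bullet> b = 0}"

definition nullity_without :: "real^'p^'m \<Rightarrow> 'm set \<Rightarrow> nat" where
  "nullity_without D B = dim (null_space_without D B)"

end

theory Submission
  imports Defs
begin

text \<open>
  The identity is Stein's formula \<open>df(g) = E[div g(y)]\<close> for the fit \<open>g(y) = X \<beta>\<^sub>\<lambda>(y)\<close>, together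
  with the fact that the divergence of \<open>g\<close> is almost everywhere the nullity of \<open>D\<^sub>-\<^sub>B\<close>.

  Let \<open>u\<close> be any dual solution at \<open>y\<close>, with boundary set \<open>B\<close>. The optimality conditions
  \<open>X\<^sup>T (y - X \<beta>) = D\<^sup>T u\<close> and \<open>u\<^sub>i (D \<beta>)\<^sub>i = \<lambda> \<bar>(D \<beta>)\<^sub>i\<bar>\<close> (\<open>solutions_kkt\<close>) place \<open>\<beta>\<close> in
  \<open>null(D\<^sub>-\<^sub>B)\<close>, and they show that \<open>g(y)\<close> is the orthogonal projection of \<open>y - a\<close> onto
  \<open>X null(D\<^sub>-\<^sub>B)\<close>, where \<open>a\<close> depends only on \<open>B\<close> and on the signs of \<open>u\<close> on \<open>B\<close>
  (\<open>fit_eq_fit_piece\<close>). So \<open>g\<close> takes its values among finitely many affine maps. The same conditions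
  show that \<open>g\<close> is nonexpansive (\<open>kkt_fit_nonexpansive\<close>), in particular continuous.

  Two different affine maps agree only on a null set. At a point outside these finitely many null
  sets, exactly one of the maps agrees with \<open>g\<close>, and by continuity it does so in a whole
  neighbourhood (\<open>eventually_eq_piece\<close>). There \<open>g\<close> is differentiable, and its divergence is the
  trace of an orthogonal projection, that is the dimension of \<open>X null(D\<^sub>-\<^sub>B)\<close>, which is the nullity
  since \<open>X\<close> is injective. All dual solutions at such a point select the same affine map, hence the
  same projection and the same null space; this is the independence of the choice.

  Stein's formula for Lipschitz functions (\<open>gaussian_stein_identity\<close>) follows from translation
  invariance of Lebesgue measure: a difference quotient of \<open>g\<close> integrated against the Gaussian
  density is \<open>g\<close> integrated against a difference quotient of the density, and dominated convergence
  applies on both sides.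
\<close>

section \<open>Optimality conditions of the generalized lasso\<close>

lemma inner_transpose_mult:
  fixes A :: "real^'p^'n"
  shows "(transpose A *v u) \<bullet> b = u \<bullet> (A *v b)"
  by (simp add: dot_lmul_matrix transpose_matrix_vector)

text \<open>
  With full column rank the Gram matrix is invertible, so that in the dual problem the pseudoinverse
  is an ordinary inverse.
\<close>

lemma pseudoinverse_invertible:
  fixes A :: "real^'p^'p"
  assumes "A ** B = mat 1" "B ** A = mat 1"
  shows "pseudoinverse A = B"
  by (rule pseudoinverse_eqI) (simp add: is_pseudoinverse_def assms transpose_mat)

lemma gram_inner:
  fixes X :: "real^'p^'n"
  shows "a \<bullet> ((transpose X ** X) *v b) = (X *v a) \<bullet> (X *v b)"
  by (metis inner_commute inner_transpose_mult matrix_vector_mul_assoc)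

lemma gram_invertible:
  fixes X :: "real^'p^'n"
  assumes "rank X = CARD('p)"
  shows "invertible (transpose X ** X)"
proof -
  have "x = 0" if "(transpose X ** X) *v x = 0" for x
  proof -
    have "(X *v x) \<bullet> (X *v x) = 0"
      using gram_inner[of x X x] that by simp
    then have "X *v x = X *v 0" by simp
    moreover have "inj ((*v) X)" using assms full_rank_injective by blast
    ultimately show ?thesis by (rule injD[rotated])
  qed
  then show ?thesis
    using invertible_left_inverse matrix_left_invertible_ker by blast
qed

lemma gram_pseudoinverse:
  fixes X :: "real^'p^'n"
  assumes "rank X = CARD('p)"
  shows "(transpose X ** X) *v (pseudoinverse (transpose X ** X) *v r) = r"
proof -
  obtain B where B: "(transpose X ** X) ** B = mat 1" "B ** (transpose X ** X) = mat 1"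
    using gram_invertible[OF assms] by (auto simp: invertible_def)
  have "(transpose X ** X) *v (B *v r) = (transpose X ** X ** B) *v r"
    by (simp only: matrix_vector_mul_assoc)
  then show ?thesis by (simp add: pseudoinverse_invertible[OF B] B)
qed

text \<open>
  Stationarity of the Lagrangian in \<open>\<beta>\<close>, namely \<open>X\<^sup>T (y - X \<beta>) = D\<^sup>T u\<close>, solved for \<open>\<beta>\<close>.
\<close>

definition stationary_primal ::
    "real^'p^'n \<Rightarrow> real^'p^'m \<Rightarrow> real^'n \<Rightarrow> real^'m \<Rightarrow> real^'p" where
  "stationary_primal X D y u = pseudoinverse (transpose X ** X) *v (transpose X *v y - transpose D *v u)"

text \<open>
  The last condition is complementary slackness in product form: together with the bound, it makes
  \<open>u\<^sub>i\<close> equal to \<open>\<lambda>\<close> times a subgradient of the absolute value at \<open>(D \<beta>)\<^sub>i\<close>.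
\<close>

definition kkt_pair ::
    "real^'p^'n \<Rightarrow> real^'p^'m \<Rightarrow> real \<Rightarrow> real^'n \<Rightarrow> real^'p \<Rightarrow> real^'m \<Rightarrow> bool" where
  "kkt_pair X D l y b u \<longleftrightarrow>
     transpose X *v (y - X *v b) = transpose D *v u \<and>
     (\<forall>i. \<bar>u $ i\<bar> \<le> l) \<and>
     (\<forall>i. u $ i * (D *v b) $ i = l * \<bar>(D *v b) $ i\<bar>)"

text \<open>
  Written as half the squared norm of the fit, the dual objective is a convex quadratic whose
  directional derivatives can be read off by expanding a square.
\<close>

lemma dual_objective_eq:
  fixes X :: "real^'p^'n"
  assumes "rank X = CARD('p)"
  shows "dual_objective X D y u = 1 / 2 * (norm (X *v stationary_primal X D y u))\<^sup>2"
proof -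
  let ?r = "transpose X *v y - transpose D *v u"
  let ?b = "stationary_primal X D y u"
  have "?r \<bullet> ?b = ?b \<bullet> ((transpose X ** X) *v ?b)"
    using gram_pseudoinverse[OF assms, of ?r] by (simp add: stationary_primal_def inner_commute)
  also have "\<dots> = (X *v ?b) \<bullet> (X *v ?b)" by (rule gram_inner)
  finally show ?thesis
    by (simp add: dual_objective_def Let_def stationary_primal_def power2_norm_eq_inner)
qed

lemma dual_feasible_iff:
  fixes X :: "real^'p^'n"
  assumes "rank X = CARD('p)"
  shows "dual_feasible X D l u \<longleftrightarrow> (\<forall>i. \<bar>u $ i\<bar> \<le> l)"
proof -
  have "dim (rows X) = DIM(real^'p)"
    using assms by (simp add: row_rank_def)
  then have "span (rows X) = UNIV"
    using dim_eq_full by blast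
  moreover have "infnorm u \<le> l \<longleftrightarrow> (\<forall>i. \<bar>u $ i\<bar> \<le> l)"
    unfolding infnorm_cart
    by (subst cSup_le_iff) (auto simp: full_SetCompr_eq intro: bdd_above_finite)
  ultimately show ?thesis by (simp add: dual_feasible_def)
qed

lemma nonneg_linear_coefficient:
  fixes a c :: real
  assumes "\<And>t. 0 < t \<Longrightarrow> t \<le> 1 \<Longrightarrow> 0 \<le> t * a + t\<^sup>2 * c"
  shows "0 \<le> a"
proof (rule tendsto_lowerbound)
  show "((\<lambda>t. a + t * c) \<longlongrightarrow> a) (at_right 0)"
    by (rule tendsto_eq_intros refl | simp)+
  have "eventually (\<lambda>t::real. 0 < t \<and> t < 1) (at_right 0)"
    using eventually_at_right_less eventually_at_right_real[of 0 1] by (auto elim: eventually_mono)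
  then show "eventually (\<lambda>t. 0 \<le> a + t * c) (at_right 0)"
  proof (rule eventually_mono)
    fix t :: real assume t: "0 < t \<and> t < 1"
    have "0 \<le> t * (a + t * c)"
      using assms[of t] t by (simp add: algebra_simps power2_eq_square)
    then show "0 \<le> a + t * c" using t by (simp add: zero_le_mult_iff)
  qed
qed simp

text \<open>
  First-order optimality on a convex set: the box contains the segment from \<open>u\<close> to \<open>v\<close>, and the
  dual objective is a quadratic polynomial along it, with linear coefficient
  \<open>- (v - u) \<bullet> D \<beta>\<close>.
\<close>

lemma dual_solution_variational:
  fixes X :: "real^'p^'n" and D :: "real^'p^'m"
  assumes rank: "rank X = CARD('p)" and u: "dual_solution X D l y u"
    and v: "\<forall>i. \<bar>v $ i\<bar> \<le> l"
  shows "(v - u) \<bullet> (D *v stationary_primal X D y u) \<le> 0"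
proof -
  let ?H = "pseudoinverse (transpose X ** X)"
  define d where "d = v - u"
  define b where "b = stationary_primal X D y u"
  define e where "e = ?H *v (transpose D *v d)"
  have box: "\<forall>i. \<bar>u $ i\<bar> \<le> l"
    using u by (simp add: dual_solution_def is_arg_min_def dual_feasible_iff[OF rank])
  have "0 \<le> t * (- (X *v b) \<bullet> (X *v e)) + t\<^sup>2 * (1/2 * (norm (X *v e))\<^sup>2)"
    if t: "0 < t" "t \<le> 1" for t :: real
  proof -
    have "\<bar>(u + t *\<^sub>R d) $ i\<bar> \<le> l" for i
    proof -
      have "\<bar>(u + t *\<^sub>R d) $ i\<bar> = \<bar>(1 - t) * u $ i + t * v $ i\<bar>"
        by (simp add: d_def algebra_simps)
      also have "\<dots> \<le> (1 - t) * \<bar>u $ i\<bar> + t * \<bar>v $ i\<bar>"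
        using t by (intro order.trans[OF abs_triangle_ineq]) (simp add: abs_mult)
      also have "\<dots> \<le> (1 - t) * l + t * l"
        using t box v by (intro add_mono mult_left_mono) auto
      finally show ?thesis by (simp add: algebra_simps)
    qed
    then have "dual_feasible X D l (u + t *\<^sub>R d)"
      unfolding dual_feasible_iff[OF rank] by blast
    then have "dual_objective X D y u \<le> dual_objective X D y (u + t *\<^sub>R d)"
      using u by (auto simp: dual_solution_def is_arg_min_def not_less)
    moreover have "stationary_primal X D y (u + t *\<^sub>R d) = b - t *\<^sub>R e"
      by (simp add: b_def e_def stationary_primal_def matrix_vector_mult_add_rdistrib
          matrix_vector_mult_diff_distrib matrix_vector_right_distrib scaleR_matrix_vector_assoc
          matrix_vector_mult_scaleR algebra_simps)
    ultimately have "(norm (X *v b))\<^sup>2 \<le> (norm (X *v b - t *\<^sub>R (X *v e)))\<^sup>2"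
      by (simp add: dual_objective_eq[OF rank] b_def matrix_vector_mult_diff_distrib
          matrix_vector_mult_scaleR)
    then show ?thesis
      unfolding power2_norm_eq_inner
      by (simp add: inner_diff inner_commute algebra_simps power2_eq_square)
  qed
  then have "0 \<le> - (X *v b) \<bullet> (X *v e)"
    by (rule nonneg_linear_coefficient)
  moreover have "(X *v b) \<bullet> (X *v e) = b \<bullet> (transpose D *v d)"
    using gram_inner[of b X e] gram_pseudoinverse[OF rank] by (simp add: e_def)
  moreover have "b \<bullet> (transpose D *v d) = d \<bullet> (D *v b)"
    by (metis inner_transpose_mult inner_commute)
  ultimately show ?thesis by (simp add: d_def b_def)
qed

text \<open>
  Moving a single coordinate \<open>u\<^sub>k\<close> to the vertex value \<open>\<lambda> sgn (D \<beta>)\<^sub>k\<close> in the variational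
  inequality gives complementary slackness at \<open>k\<close>.
\<close>

lemma dual_solution_kkt:
  fixes X :: "real^'p^'n" and D :: "real^'p^'m"
  assumes rank: "rank X = CARD('p)" and l: "0 \<le> l" and u: "dual_solution X D l y u"
  shows "kkt_pair X D l y (stationary_primal X D y u) u"
proof -
  define b where "b = stationary_primal X D y u"
  have box: "\<forall>i. \<bar>u $ i\<bar> \<le> l"
    using u by (simp add: dual_solution_def is_arg_min_def dual_feasible_iff[OF rank])
  have "(transpose X ** X) *v b = transpose X *v y - transpose D *v u"
    unfolding b_def stationary_primal_def by (rule gram_pseudoinverse[OF rank])
  then have stat: "transpose X *v (y - X *v b) = transpose D *v u"
    by (simp add: matrix_vector_mult_diff_distrib matrix_vector_mul_assoc)
  have "u $ k * (D *v b) $ k = l * \<bar>(D *v b) $ k\<bar>" for k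
  proof -
    define v where "v = u + axis k (l * sgn ((D *v b) $ k) - u $ k)"
    have "\<bar>v $ i\<bar> \<le> l" for i
      using box l by (auto simp: v_def axis_def sgn_real_def)
    then have "(v - u) \<bullet> (D *v b) \<le> 0"
      unfolding b_def by (intro dual_solution_variational[OF rank u]) auto
    then have "(l * sgn ((D *v b) $ k) - u $ k) * (D *v b) $ k \<le> 0"
      by (simp add: v_def inner_axis' )
    then have "l * \<bar>(D *v b) $ k\<bar> \<le> u $ k * (D *v b) $ k"
      by (simp add: algebra_simps abs_sgn)
    moreover have "u $ k * (D *v b) $ k \<le> l * \<bar>(D *v b) $ k\<bar>"
      using mult_right_mono[OF box[rule_format, of k], of "\<bar>(D *v b) $ k\<bar>"]
      by (simp flip: abs_mult)
    ultimately show ?thesis by simp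
  qed
  with box stat show ?thesis
    by (simp add: kkt_pair_def flip: b_def)
qed

text \<open>
  The residual \<open>y - X b\<close> is, through \<open>X\<^sup>T\<close>, a subgradient of the penalty at \<open>b\<close>. This
  inequality yields both uniqueness of the primal solution and the contraction property of the fit.
\<close>

lemma kkt_variational:
  fixes X :: "real^'p^'n" and D :: "real^'p^'m"
  assumes "kkt_pair X D l y b u"
  shows "(y - X *v b) \<bullet> (X *v (c - b)) \<le>
    l * (\<Sum>i\<in>UNIV. \<bar>(D *v c) $ i\<bar>) - l * (\<Sum>i\<in>UNIV. \<bar>(D *v b) $ i\<bar>)"
proof -
  note k = assms[unfolded kkt_pair_def]
  have "(y - X *v b) \<bullet> (X *v (c - b)) = u \<bullet> (D *v (c - b))"
    using k by (metis inner_transpose_mult)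
  also have "\<dots> = (\<Sum>i\<in>UNIV. u $ i * (D *v c) $ i) - (\<Sum>i\<in>UNIV. u $ i * (D *v b) $ i)"
    by (simp add: inner_vec_def matrix_vector_mult_diff_distrib sum_subtractf algebra_simps)
  also have "(\<Sum>i\<in>UNIV. u $ i * (D *v b) $ i) = l * (\<Sum>i\<in>UNIV. \<bar>(D *v b) $ i\<bar>)"
    using k by (simp add: sum_distrib_left)
  also have "(\<Sum>i\<in>UNIV. u $ i * (D *v c) $ i) \<le> l * (\<Sum>i\<in>UNIV. \<bar>(D *v c) $ i\<bar>)"
    unfolding sum_distrib_left
  proof (rule sum_mono)
    fix i
    show "u $ i * (D *v c) $ i \<le> l * \<bar>(D *v c) $ i\<bar>"
      using k mult_right_mono[of "\<bar>u $ i\<bar>" l "\<bar>(D *v c) $ i\<bar>"]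
      by (simp flip: abs_mult)
  qed
  finally show ?thesis by simp
qed

text \<open>
  Expanding the square and using the variational inequality, the objective at \<open>c\<close> exceeds the one at
  \<open>b\<close> by at least \<open>\<parallel>X (c - b)\<parallel>\<^sup>2 / 2\<close>, and \<open>X\<close> is injective.
\<close>

lemma kkt_primal_solution_eq:
  fixes X :: "real^'p^'n" and D :: "real^'p^'m"
  assumes rank: "rank X = CARD('p)" and k: "kkt_pair X D l y b u"
    and c: "genlasso_solution X D l y c"
  shows "c = b"
proof -
  have "genlasso_objective X D l y c \<le> genlasso_objective X D l y b"
    using c by (auto simp: genlasso_solution_def is_arg_min_def not_less)
  moreover have "y - X *v c = (y - X *v b) - X *v (c - b)"
    by (simp add: matrix_vector_mult_diff_distrib)
  then have "(norm (y - X *v c))\<^sup>2 = (norm (y - X *v b))\<^sup>2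
      - 2 * ((y - X *v b) \<bullet> (X *v (c - b))) + (norm (X *v (c - b)))\<^sup>2"
    by (simp only: power2_norm_eq_inner) (simp add: inner_diff inner_commute)
  ultimately have "(norm (X *v (c - b)))\<^sup>2 \<le> 0"
    using kkt_variational[OF k, of c] unfolding genlasso_objective_def by linarith
  then have "X *v (c - b) = X *v 0" by simp
  moreover have "inj ((*v) X)" using rank full_rank_injective by blast
  ultimately show ?thesis by (metis eq_iff_diff_eq_0 injD)
qed

text \<open>
  Every dual solution is linked to the primal solution, not just one that comes from a particular
  duality argument; this is what later makes the choice of dual solution irrelevant.
\<close>

lemma solutions_kkt:
  fixes X :: "real^'p^'n" and D :: "real^'p^'m"
  assumes "rank X = CARD('p)" "0 \<le> l" "dual_solution X D l y u" "genlasso_solution X D l y b"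
  shows "kkt_pair X D l y b u"
  using dual_solution_kkt kkt_primal_solution_eq assms by metis

text \<open>
  Testing each of the two variational inequalities with the other solution and adding them cancels
  the penalties, as for the residual of a projection onto a convex set.
\<close>

lemma kkt_fit_nonexpansive:
  fixes X :: "real^'p^'n" and D :: "real^'p^'m"
  assumes "kkt_pair X D l y b u" "kkt_pair X D l z c v"
  shows "norm (X *v b - X *v c) \<le> norm (y - z)"
proof -
  define e where "e = X *v b - X *v c"
  have "(y - X *v b) \<bullet> (- e) + (z - X *v c) \<bullet> e \<le> 0"
    using kkt_variational[OF assms(1), of c] kkt_variational[OF assms(2), of b]
    by (simp add: e_def matrix_vector_mult_diff_distrib algebra_simps)
  then have "(norm e)\<^sup>2 \<le> (y - z) \<bullet> e"
    unfolding power2_norm_eq_inner by (simp add: e_def algebra_simps inner_diff)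
  also have "\<dots> \<le> norm (y - z) * norm e" by (rule norm_cauchy_schwarz)
  finally have "norm e * norm e \<le> norm (y - z) * norm e" by (simp add: power2_eq_square)
  then show ?thesis unfolding e_def[symmetric]
    by (cases "norm e = 0") (auto simp: mult_le_cancel_right)
qed

text \<open>
  Off the boundary set \<open>\<bar>u\<^sub>i\<bar> < \<lambda>\<close>, and complementary slackness then forces \<open>(D \<beta>)\<^sub>i = 0\<close>.
\<close>

lemma kkt_null_space:
  fixes X :: "real^'p^'n" and D :: "real^'p^'m"
  assumes "kkt_pair X D l y b u"
  shows "b \<in> null_space_without D (boundary_set l u)"
proof -
  have "(D *v b) $ i = 0" if "i \<notin> boundary_set l u" for i
  proof (rule ccontr)
    assume *: "(D *v b) $ i \<noteq> 0"
    have "\<bar>u $ i\<bar> * \<bar>(D *v b) $ i\<bar> = \<bar>l\<bar> * \<bar>(D *v b) $ i\<bar>"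
      using assms by (metis kkt_pair_def abs_abs abs_mult)
    with * have "\<bar>u $ i\<bar> = \<bar>l\<bar>" by simp
    moreover have "0 \<le> l" using assms by (metis kkt_pair_def abs_ge_zero order.trans)
    ultimately show False using that by (simp add: boundary_set_def)
  qed
  then show ?thesis
    by (simp add: null_space_without_def row_def matrix_vector_mult_def inner_vec_def)
qed

section \<open>Orthogonal projections\<close>

definition orthonormal_basis :: "'a::euclidean_space set \<Rightarrow> 'a set" where
  "orthonormal_basis V = (SOME E. pairwise orthogonal E \<and> (\<forall>e\<in>E. norm e = 1) \<and> finite E \<and>
     card E = dim V \<and> span E = V)"

lemma orthonormal_basis:
  assumes "subspace V"
  shows "pairwise orthogonal (orthonormal_basis V)" "\<And>e. e \<in> orthonormal_basis V \<Longrightarrow> norm e = 1"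
    "finite (orthonormal_basis V)" "card (orthonormal_basis V) = dim V" "span (orthonormal_basis V) = V"
proof -
  have "\<exists>E. pairwise orthogonal E \<and> (\<forall>e\<in>E. norm e = 1) \<and> finite E \<and> card E = dim V \<and> span E = V"
    by (rule orthonormal_basis_subspace[OF assms]) (metis independent_imp_finite)
  from someI_ex[OF this]
  show "pairwise orthogonal (orthonormal_basis V)" "\<And>e. e \<in> orthonormal_basis V \<Longrightarrow> norm e = 1"
    "finite (orthonormal_basis V)" "card (orthonormal_basis V) = dim V" "span (orthonormal_basis V) = V"
    unfolding orthonormal_basis_def by blast+
qed

text \<open>
  The expansion in an orthonormal basis makes linearity evident and reduces the trace to a count of
  basis vectors.
\<close>

definition orth_proj :: "'a::euclidean_space set \<Rightarrow> 'a \<Rightarrow> 'a" where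
  "orth_proj V y = (\<Sum>e\<in>orthonormal_basis V. (y \<bullet> e) *\<^sub>R e)"

lemma linear_orth_proj: "linear (orth_proj V)"
  unfolding orth_proj_def
  by (intro linearI) (auto simp: inner_add_left scaleR_add_left sum.distrib scaleR_sum_right)

lemma orth_proj_in:
  assumes "subspace V"
  shows "orth_proj V y \<in> V"
proof -
  have "orth_proj V y \<in> span (orthonormal_basis V)"
    unfolding orth_proj_def by (intro span_sum span_scale span_base)
  then show ?thesis by (simp add: orthonormal_basis(5)[OF assms])
qed

lemma orth_proj_residual:
  assumes V: "subspace V" and v: "v \<in> V"
  shows "(y - orth_proj V y) \<bullet> v = 0"
proof -
  note o = orthonormal_basis[OF V]
  have "(y - orth_proj V y) \<bullet> f = 0" if f: "f \<in> orthonormal_basis V" for f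
  proof -
    have "orth_proj V y \<bullet> f = (\<Sum>e\<in>orthonormal_basis V. if e = f then y \<bullet> f else 0)"
      unfolding orth_proj_def inner_sum_left
      using o(1,2) f
      by (intro sum.cong) (auto simp: pairwise_def orthogonal_def norm_eq_1)
    also have "\<dots> = y \<bullet> f" using o(3) f by simp
    finally show ?thesis by (simp add: inner_diff)
  qed
  then have "orthogonal (y - orth_proj V y) v"
    using v o(5) by (intro orthogonal_to_span[of v "orthonormal_basis V"]) (auto simp: orthogonal_def)
  then show ?thesis by (simp add: orthogonal_def)
qed

lemma orth_proj_unique:
  assumes V: "subspace V" and p: "p \<in> V" and r: "\<And>v. v \<in> V \<Longrightarrow> (y - p) \<bullet> v = 0"
  shows "orth_proj V y = p"
proof -
  let ?d = "orth_proj V y - p"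
  have d: "?d \<in> V" using V p orth_proj_in subspace_diff by blast
  have "?d \<bullet> ?d = (y - p) \<bullet> ?d - (y - orth_proj V y) \<bullet> ?d"
    by (simp add: inner_diff)
  also have "\<dots> = 0" using r[OF d] orth_proj_residual[OF V d] by simp
  finally show ?thesis by simp
qed

lemma range_orth_proj:
  assumes "subspace V"
  shows "range (orth_proj V) = V"
proof
  show "range (orth_proj V) \<subseteq> V" using orth_proj_in[OF assms] by auto
  show "V \<subseteq> range (orth_proj V)"
    using orth_proj_unique[OF assms] by (metis cancel_comm_monoid_add_class.diff_cancel inner_zero_left rangeI subsetI)
qed

lemma trace_orth_proj:
  fixes V :: "(real^'n) set"
  assumes "subspace V"
  shows "(\<Sum>i\<in>UNIV. orth_proj V (axis i 1) $ i) = dim V"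
proof -
  have "(\<Sum>i\<in>UNIV. orth_proj V (axis i 1) $ i) = (\<Sum>i\<in>UNIV. \<Sum>e\<in>orthonormal_basis V. e $ i * e $ i)"
    by (simp add: orth_proj_def inner_axis')
  also have "\<dots> = (\<Sum>e\<in>orthonormal_basis V. \<Sum>i\<in>UNIV. e $ i * e $ i)" by (rule sum.swap)
  also have "\<dots> = (\<Sum>e\<in>orthonormal_basis V. 1)"
    using orthonormal_basis(2)[OF assms] by (intro sum.cong) (auto simp: norm_eq_1 inner_vec_def)
  finally show ?thesis by (simp add: orthonormal_basis(4)[OF assms])
qed

section \<open>Continuous selections from finitely many affine maps\<close>

text \<open>
  The points at which two different members of \<open>\<A>\<close> agree. For a finite family of affine maps this is
  a finite union of proper affine subspaces.
\<close>

definition tie_set :: "('a \<Rightarrow> 'b) set \<Rightarrow> 'a set" where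
  "tie_set \<A> = (\<Union>A\<in>\<A>. \<Union>A'\<in>\<A> - {A}. {y. A y = A' y})"

lemma continuous_on_affine:
  fixes A :: "'a::euclidean_space \<Rightarrow> 'b::real_normed_vector"
  assumes "linear (\<lambda>y. A y - A 0)"
  shows "continuous_on S A"
proof -
  have "continuous_on S (\<lambda>y. (A y - A 0) + A 0)"
    using assms by (intro continuous_on_add continuous_on_const linear_continuous_on)
      (simp add: linear_conv_bounded_linear)
  then show ?thesis by simp
qed

text \<open>
  Some coordinate of the difference of the two maps is an affine function that is not identically
  zero, so the set lies in a hyperplane or is empty.
\<close>

lemma null_set_affine_agree:
  fixes A A' :: "'a::euclidean_space \<Rightarrow> 'b::euclidean_space"
  assumes A: "linear (\<lambda>y. A y - A 0)" and A': "linear (\<lambda>y. A' y - A' 0)" and ne: "A \<noteq> A'"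
  shows "{y. A y = A' y} \<in> null_sets lborel"
proof -
  obtain y0 where "A y0 \<noteq> A' y0" using ne by blast
  then obtain b where b: "b \<in> Basis" "A y0 \<bullet> b \<noteq> A' y0 \<bullet> b"
    using euclidean_eqI by blast
  define L where "L y = ((A y - A 0) - (A' y - A' 0)) \<bullet> b" for y
  have "linear L"
    unfolding L_def by (intro linear_compose[OF linear_compose_sub[OF A A'], unfolded o_def]
        bounded_linear.linear bounded_linear_inner_left)
  then have L: "L y = adjoint L 1 \<bullet> y" for y
    using adjoint_works[of L y 1] by (simp add: inner_commute)
  define c where "c = (A' 0 - A 0) \<bullet> b"
  have sub: "{y. A y = A' y} \<subseteq> {y. adjoint L 1 \<bullet> y = c}"
    unfolding L[symmetric] by (auto simp: L_def c_def inner_diff)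
  have "adjoint L 1 \<noteq> 0 \<or> c \<noteq> 0"
    using b(2) L[of y0] by (auto simp: L_def c_def inner_diff)
  then have "negligible {y. adjoint L 1 \<bullet> y = c}" by (rule negligible_hyperplane)
  then have "negligible {y. A y = A' y}" using sub by (rule negligible_subset)
  moreover have "A \<in> borel_measurable borel" "A' \<in> borel_measurable borel"
    using A A' by (auto intro: borel_measurable_continuous_onI continuous_on_affine)
  then have "{y. A y = A' y} \<in> sets borel" by measurable
  ultimately show ?thesis
    by (simp add: negligible_iff_null_sets null_sets_completion_iff)
qed

lemma tie_set_null:
  fixes \<A> :: "('a::euclidean_space \<Rightarrow> 'b::euclidean_space) set"
  assumes "finite \<A>" and "\<And>A. A \<in> \<A> \<Longrightarrow> linear (\<lambda>y. A y - A 0)"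
  shows "tie_set \<A> \<in> null_sets lborel"
  unfolding tie_set_def using assms
  by (intro null_sets.finite_UN null_set_affine_agree) auto

text \<open>
  A continuous selection from finitely many continuous maps can change from one map to another only
  where two of them agree.
\<close>

lemma eventually_eq_piece:
  fixes g :: "'a::t2_space \<Rightarrow> 'b::t2_space"
  assumes fin: "finite \<A>" and cont: "\<And>A. A \<in> \<A> \<Longrightarrow> continuous_on UNIV A"
    and g: "continuous_on UNIV g" and sel: "\<And>z. \<exists>A\<in>\<A>. g z = A z"
    and y: "y \<notin> tie_set \<A>" and A: "A \<in> \<A>" "g y = A y"
  shows "eventually (\<lambda>z. g z = A z) (nhds y)"
proof -
  have "eventually (\<lambda>z. g z \<noteq> A' z) (nhds y)" if A': "A' \<in> \<A> - {A}" for A'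
  proof (rule eventually_nhds_in_open[of "{z. g z \<noteq> A' z}", simplified])
    show "open {z. g z \<noteq> A' z}"
      using A' by (intro open_Collect_neq g cont) auto
    show "g y \<noteq> A' y" using y A A' by (auto simp: tie_set_def)
  qed
  then have "eventually (\<lambda>z. \<forall>A'\<in>\<A> - {A}. g z \<noteq> A' z) (nhds y)"
    using fin by (simp add: eventually_ball_finite_distrib)
  then show ?thesis
    by eventually_elim (use sel in blast)
qed

section \<open>The affine pieces of the fit\<close>

text \<open>
  The part of a dual solution that is determined by its boundary set \<open>B\<close> and by the set \<open>S\<close> of
  indices at which it equals \<open>\<lambda>\<close>.
\<close>

definition signed_vertex :: "real \<Rightarrow> 'm set \<Rightarrow> 'm set \<Rightarrow> real^'m" where
  "signed_vertex l B S = (\<chi> i. if i \<in> B then if i \<in> S then l else - l else 0)"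

text \<open>
  An affine map whose linear part is the orthogonal projection onto the image of
  \<open>null(D\<^sub>-\<^sub>B)\<close> under \<open>X\<close>; the signs enter only the translation.
\<close>

definition fit_piece ::
    "real^'p^'n \<Rightarrow> real^'p^'m \<Rightarrow> real \<Rightarrow> 'm set \<Rightarrow> 'm set \<Rightarrow> real^'n \<Rightarrow> real^'n" where
  "fit_piece X D l B S y = orth_proj ((*v) X ` null_space_without D B)
     (y - X *v (pseudoinverse (transpose X ** X) *v (transpose D *v signed_vertex l B S)))"

text \<open>
  An affine map whose linear part is the orthogonal projection onto the image of
  \<open>null(D\<^sub>-\<^sub>B)\<close> under \<open>X\<close>; the signs enter only the translation.
\<close>

definition fit_pieces :: "real^'p^'n \<Rightarrow> real^'p^'m \<Rightarrow> real \<Rightarrow> (real^'n \<Rightarrow> real^'n) set" where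
  "fit_pieces X D l = (\<lambda>(B, S). fit_piece X D l B S) ` UNIV"

lemma subspace_null_space_without: "subspace (null_space_without D B)"
  by (auto simp: subspace_def null_space_without_def inner_add_right)

lemma subspace_image_null_space: "subspace ((*v) X ` null_space_without D B)"
  for X :: "real^'p^'n"
  by (intro linear_subspace_image subspace_null_space_without matrix_vector_mul_linear)

lemma finite_fit_pieces: "finite (fit_pieces X D l)"
  unfolding fit_pieces_def by simp

lemma fit_piece_diff:
  "fit_piece X D l B S y - fit_piece X D l B S z =
     orth_proj ((*v) X ` null_space_without D B) (y - z)"
  by (simp add: fit_piece_def flip: linear_diff[OF linear_orth_proj])

lemma linear_fit_pieces:
  assumes "A \<in> fit_pieces X D l"
  shows "linear (\<lambda>y. A y - A 0)"
  using assms by (auto simp: fit_pieces_def fit_piece_diff linear_orth_proj)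

text \<open>
  For \<open>c \<in> null(D\<^sub>-\<^sub>B)\<close>, the product \<open>u \<bullet> D c\<close> sees only the coordinates of \<open>u\<close> in \<open>B\<close>. Hence
  stationarity determines \<open>X b\<close> on the subspace \<open>X null(D\<^sub>-\<^sub>B)\<close>, to which \<open>X b\<close> belongs, from \<open>y\<close>,
  \<open>B\<close> and the signs alone.
\<close>

lemma fit_eq_fit_piece:
  fixes X :: "real^'p^'n" and D :: "real^'p^'m"
  assumes rank: "rank X = CARD('p)" and k: "kkt_pair X D l y b u"
  shows "X *v b = fit_piece X D l (boundary_set l u) {i. u $ i = l} y"
proof -
  define B where "B = boundary_set l u"
  define v where "v = signed_vertex l B {i. u $ i = l}"
  let ?H = "pseudoinverse (transpose X ** X)"
  have v: "v $ i = u $ i" if "i \<in> B" for i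
    using that by (auto simp: v_def signed_vertex_def B_def boundary_set_def)
  have "(y - X *v (?H *v (transpose D *v v)) - X *v b) \<bullet> (X *v c) = 0"
    if c: "c \<in> null_space_without D B" for c
  proof -
    have Dc: "(D *v c) $ i = 0" if "i \<notin> B" for i
      using c that by (simp add: null_space_without_def row_def matrix_vector_mult_def inner_vec_def)
    have "(y - X *v b) \<bullet> (X *v c) = u \<bullet> (D *v c)"
      using k by (metis inner_transpose_mult kkt_pair_def)
    also have "\<dots> = v \<bullet> (D *v c)"
      unfolding inner_vec_def using v Dc by (intro sum.cong) force+
    also have "\<dots> = (X *v (?H *v (transpose D *v v))) \<bullet> (X *v c)"
      by (metis gram_inner gram_pseudoinverse[OF rank] inner_commute inner_transpose_mult)
    finally show ?thesis by (simp add: inner_diff)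
  qed
  moreover have "b \<in> null_space_without D B"
    unfolding B_def by (rule kkt_null_space[OF k])
  ultimately have "orth_proj ((*v) X ` null_space_without D B)
      (y - X *v (?H *v (transpose D *v v))) = X *v b"
    by (intro orth_proj_unique subspace_image_null_space) auto
  then show ?thesis by (simp add: fit_piece_def v_def B_def)
qed

lemma image_null_space_of_fit_piece:
  fixes X :: "real^'p^'n"
  shows "range (\<lambda>y. fit_piece X D l B S y - fit_piece X D l B S 0) =
    (*v) X ` null_space_without D B"
  by (simp add: fit_piece_diff range_orth_proj[OF subspace_image_null_space])

lemma fit_piece_trace:
  fixes X :: "real^'p^'n"
  assumes "rank X = CARD('p)"
  shows "(\<Sum>i\<in>UNIV. (fit_piece X D l B S (axis i 1) - fit_piece X D l B S 0) $ i) =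
    real (nullity_without D B)"
proof -
  have "inj ((*v) X)" using assms full_rank_injective by blast
  then have "dim ((*v) X ` null_space_without D B) = dim (null_space_without D B)"
    by (intro dim_image_eq) (auto intro: inj_on_subset simp: matrix_vector_mul_linear)
  then show ?thesis
    by (simp add: fit_piece_diff trace_orth_proj[OF subspace_image_null_space] nullity_without_def
        del: vector_minus_component)
qed

section \<open>Stein's identity for Lipschitz functions\<close>

definition gauss :: "real^'n \<Rightarrow> real \<Rightarrow> real^'n \<Rightarrow> real" where
  "gauss \<mu> \<sigma> y = (\<Prod>i\<in>UNIV. normal_density (\<mu> $ i) \<sigma> (y $ i))"

lemma borel_measurable_vec_nth [measurable (raw)]:
  fixes f :: "'a \<Rightarrow> real^'n"
  assumes "f \<in> borel_measurable M"
  shows "(\<lambda>x. f x $ i) \<in> borel_measurable M"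
  by (rule borel_measurable_continuous_on[OF _ assms]) (intro continuous_intros)

lemma gauss_nonneg: "0 \<le> gauss \<mu> \<sigma> y"
  unfolding gauss_def by (intro prod_nonneg) auto

lemma gauss_measurable [measurable]: "gauss \<mu> \<sigma> \<in> borel_measurable borel"
  unfolding gauss_def[abs_def] by measurable

lemma gauss_eq_exp:
  fixes \<mu> :: "real^'n"
  shows "gauss \<mu> \<sigma> y =
    (1 / sqrt (2 * pi * \<sigma>\<^sup>2)) ^ CARD('n) * exp (- (norm (y - \<mu>))\<^sup>2 / (2 * \<sigma>\<^sup>2))"
proof -
  have "(norm (y - \<mu>))\<^sup>2 = (\<Sum>i\<in>UNIV. (y $ i - \<mu> $ i)\<^sup>2)"
    unfolding power2_norm_eq_inner by (simp add: inner_vec_def power2_eq_square)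
  then have "exp (- (norm (y - \<mu>))\<^sup>2 / (2 * \<sigma>\<^sup>2)) =
      (\<Prod>i\<in>UNIV. exp (- (y $ i - \<mu> $ i)\<^sup>2 / (2 * \<sigma>\<^sup>2)))"
    by (simp flip: exp_sum add: sum_negf sum_divide_distrib)
  then show ?thesis
    by (simp only: gauss_def normal_density_def prod.distrib prod_constant)
qed

lemma integrable_gauss:
  fixes \<mu> :: "real^'n"
  assumes "0 < \<sigma>"
  shows "integrable lborel (gauss \<mu> \<sigma>)"
proof (rule integrableI_nonneg)
  have "(\<integral>\<^sup>+ y. ennreal (gauss \<mu> \<sigma> y) \<partial>lborel) =
      (\<integral>\<^sup>+ y. (\<Prod>b\<in>Basis. ennreal (normal_density (\<mu> \<bullet> b) \<sigma> (y \<bullet> b))) \<partial>lborel)"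
  proof (intro nn_integral_cong)
    fix y :: "real^'n"
    have B: "(Basis :: (real^'n) set) = range (\<lambda>i. axis i 1)"
      by (auto simp: Basis_vec_def)
    have "inj (\<lambda>i::'n. axis i (1::real))" by (auto simp: inj_on_def axis_eq_axis)
    then show "ennreal (gauss \<mu> \<sigma> y) =
        (\<Prod>b\<in>Basis. ennreal (normal_density (\<mu> \<bullet> b) \<sigma> (y \<bullet> b)))"
      unfolding B by (subst prod.reindex) (auto simp: gauss_def prod_ennreal inner_axis)
  qed
  also have "\<dots> = (\<Prod>b\<in>Basis. \<integral>\<^sup>+ t. ennreal (normal_density (\<mu> \<bullet> b) \<sigma> t) \<partial>lborel)"
    by (rule nn_integral_lborel_prod) auto
  also have "\<dots> = 1"
    using assms by (intro prod.neutral) (auto simp: nn_integral_eq_integral)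
  finally show "(\<integral>\<^sup>+ y. ennreal (gauss \<mu> \<sigma> y) \<partial>lborel) < \<infinity>" by simp
qed (auto simp: gauss_nonneg)

text \<open>
  A Lipschitz function, and the ratio of a difference quotient of the density to the density itself,
  grow at most exponentially in the norm; the dominating functions for them rest on this.
\<close>

lemma integrable_gauss_exp_norm:
  fixes \<mu> :: "real^'n"
  assumes \<sigma>: "0 < \<sigma>"
  shows "integrable lborel (\<lambda>y. gauss \<mu> \<sigma> y * exp (a * norm (y - \<mu>)))"
proof (rule Bochner_Integration.integrable_bound)
  (* Completing the square absorbs the exponential factor into a Gaussian of twice the standard
     deviation. *)
  define K where "K = (1 / sqrt (2 * pi * \<sigma>\<^sup>2)) ^ CARD('n)"
  define K' where "K' = (1 / sqrt (2 * pi * (2 * \<sigma>)\<^sup>2)) ^ CARD('n)"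
  have K: "0 < K" "0 < K'" using \<sigma> by (auto simp: K_def K'_def)
  show "integrable lborel (\<lambda>y. K / K' * exp (a\<^sup>2 * \<sigma>\<^sup>2) * gauss \<mu> (2 * \<sigma>) y)"
    using integrable_gauss[of "2 * \<sigma>" \<mu>] \<sigma> by (intro integrable_mult_right) auto
  have bound: "gauss \<mu> \<sigma> y * exp (a * norm (y - \<mu>)) \<le> K / K' * exp (a\<^sup>2 * \<sigma>\<^sup>2) * gauss \<mu> (2 * \<sigma>) y"
    for y
  proof -
    define r where "r = norm (y - \<mu>)"
    have "0 \<le> (r / \<sigma> / 2 - a * \<sigma>)\<^sup>2 + (r / \<sigma>)\<^sup>2 / 8" by simp
    also have "\<dots> = r\<^sup>2 / (2 * \<sigma>\<^sup>2) - a * r + a\<^sup>2 * \<sigma>\<^sup>2 - r\<^sup>2 / (2 * (2 * \<sigma>)\<^sup>2)"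
      using \<sigma> by (simp add: power2_eq_square field_simps)
    finally have "exp (- r\<^sup>2 / (2 * \<sigma>\<^sup>2) + a * r) \<le> exp (a\<^sup>2 * \<sigma>\<^sup>2 + - r\<^sup>2 / (2 * (2 * \<sigma>)\<^sup>2))"
      by simp
    then have "K * exp (- r\<^sup>2 / (2 * \<sigma>\<^sup>2) + a * r) \<le> K * exp (a\<^sup>2 * \<sigma>\<^sup>2 + - r\<^sup>2 / (2 * (2 * \<sigma>)\<^sup>2))"
      using K by (intro mult_left_mono) auto
    moreover have "gauss \<mu> \<sigma> y * exp (a * r) = K * exp (- r\<^sup>2 / (2 * \<sigma>\<^sup>2) + a * r)"
      unfolding gauss_eq_exp K_def[symmetric] r_def[symmetric] exp_add by simp
    moreover have "K / K' * exp (a\<^sup>2 * \<sigma>\<^sup>2) * gauss \<mu> (2 * \<sigma>) y =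
        K * exp (a\<^sup>2 * \<sigma>\<^sup>2 + - r\<^sup>2 / (2 * (2 * \<sigma>)\<^sup>2))"
      unfolding gauss_eq_exp K'_def[symmetric] r_def[symmetric] exp_add using K by simp
    ultimately show ?thesis by (simp only: r_def)
  qed
  show "AE y in lborel. norm (gauss \<mu> \<sigma> y * exp (a * norm (y - \<mu>)))
      \<le> norm (K / K' * exp (a\<^sup>2 * \<sigma>\<^sup>2) * gauss \<mu> (2 * \<sigma>) y)"
    using bound K by (intro AE_I2) (simp add: abs_mult gauss_nonneg)
qed auto

lemma integrable_gauss_exp_bound:
  fixes \<mu> :: "real^'n" and f :: "real^'n \<Rightarrow> real"
  assumes \<sigma>: "0 < \<sigma>" and [measurable]: "f \<in> borel_measurable borel"
    and f: "\<And>y. \<bar>f y\<bar> \<le> C * exp (a * norm (y - \<mu>))"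
  shows "integrable lborel (\<lambda>y. gauss \<mu> \<sigma> y * f y)"
proof (rule Bochner_Integration.integrable_bound)
  show "integrable lborel (\<lambda>y. C * (gauss \<mu> \<sigma> y * exp (a * norm (y - \<mu>))))"
    using integrable_gauss_exp_norm[OF \<sigma>] by (intro integrable_mult_right)
  have "\<bar>gauss \<mu> \<sigma> y * f y\<bar> \<le> \<bar>C * (gauss \<mu> \<sigma> y * exp (a * norm (y - \<mu>)))\<bar>" for y
  proof -
    have "\<bar>gauss \<mu> \<sigma> y * f y\<bar> \<le> gauss \<mu> \<sigma> y * (C * exp (a * norm (y - \<mu>)))"
      using f[of y] by (simp add: abs_mult gauss_nonneg mult_left_mono)
    then show ?thesis by (simp add: mult_ac)
  qed
  then show "AE y in lborel. norm (gauss \<mu> \<sigma> y * f y)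
      \<le> norm (C * (gauss \<mu> \<sigma> y * exp (a * norm (y - \<mu>))))"
    by simp
qed auto

text \<open>
  Moving the argument multiplies the density by an explicit factor, so the difference quotient of the
  density becomes a difference quotient of an exponential times the density.
\<close>

lemma gauss_shift:
  fixes \<mu> :: "real^'n"
  assumes "0 < \<sigma>"
  shows "gauss \<mu> \<sigma> (y - h *\<^sub>R axis i 1) =
    gauss \<mu> \<sigma> y * exp ((2 * h * (y - \<mu>) $ i - h\<^sup>2) / (2 * \<sigma>\<^sup>2))"
proof -
  have "(norm (y - h *\<^sub>R axis i 1 - \<mu>))\<^sup>2 = (norm (y - \<mu>))\<^sup>2 - (2 * h * (y - \<mu>) $ i - h\<^sup>2)"
    unfolding power2_norm_eq_inner
    by (simp add: inner_diff inner_axis inner_axis' algebra_simps power2_eq_square)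
  then have "exp (- (norm (y - h *\<^sub>R axis i 1 - \<mu>))\<^sup>2 / (2 * \<sigma>\<^sup>2)) =
      exp (- (norm (y - \<mu>))\<^sup>2 / (2 * \<sigma>\<^sup>2)) * exp ((2 * h * (y - \<mu>) $ i - h\<^sup>2) / (2 * \<sigma>\<^sup>2))"
    unfolding exp_add[symmetric] add_divide_distrib[symmetric] by simp
  then show ?thesis by (simp add: gauss_eq_exp)
qed

lemma abs_exp_diff_one_le: "\<bar>exp t - 1\<bar> \<le> \<bar>t\<bar> * exp \<bar>t\<bar>" for t :: real
proof (cases "0 \<le> t")
  case True
  have "1 - t \<le> exp (- t)" using exp_ge_add_one_self[of "- t"] by simp
  then have "(1 - t) * exp t \<le> exp (- t) * exp t" by (intro mult_right_mono) auto
  with True show ?thesis by (simp add: algebra_simps flip: exp_add)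
next
  case False
  have "\<bar>exp t - 1\<bar> = 1 - exp t" using False by simp
  then have "\<bar>exp t - 1\<bar> \<le> \<bar>t\<bar> * 1" using False exp_ge_add_one_self[of t] by linarith
  also have "\<dots> \<le> \<bar>t\<bar> * exp \<bar>t\<bar>" by (intro mult_left_mono) auto
  finally show ?thesis .
qed

lemma lipschitz_exp_bound:
  fixes f :: "'a::real_normed_vector \<Rightarrow> real"
  assumes lip: "\<And>x y. \<bar>f x - f y\<bar> \<le> C * norm (x - y)"
  shows "\<bar>f y\<bar> \<le> (\<bar>f \<mu>\<bar> + \<bar>C\<bar>) * exp (norm (y - \<mu>))"
proof -
  have e: "norm (y - \<mu>) \<le> exp (norm (y - \<mu>))"
    using exp_ge_add_one_self[of "norm (y - \<mu>)"] by linarith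
  have "\<bar>f y\<bar> \<le> \<bar>f \<mu>\<bar> * 1 + \<bar>C\<bar> * norm (y - \<mu>)"
    using lip[of y \<mu>] mult_right_mono[OF abs_ge_self[of C] norm_ge_zero[of "y - \<mu>"]] by linarith
  also have "\<dots> \<le> \<bar>f \<mu>\<bar> * exp (norm (y - \<mu>)) + \<bar>C\<bar> * exp (norm (y - \<mu>))"
    by (intro add_mono mult_left_mono e) auto
  finally show ?thesis by (simp add: algebra_simps)
qed

lemma gauss_quotient_bound:
  fixes \<mu> :: "real^'n"
  assumes \<sigma>: "0 < \<sigma>" and h: "0 < h" "h \<le> 1"
  shows "\<bar>(exp ((2 * h * (y - \<mu>) $ i - h\<^sup>2) / (2 * \<sigma>\<^sup>2)) - 1) / h\<bar>
    \<le> exp (1 / \<sigma>\<^sup>2) / \<sigma>\<^sup>2 * exp ((1 + 1 / \<sigma>\<^sup>2) * norm (y - \<mu>))"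
proof -
  define r where "r = norm (y - \<mu>)"
  define z where "z = (y - \<mu>) $ i"
  define t where "t = (2 * h * z - h\<^sup>2) / (2 * \<sigma>\<^sup>2)"
  have r: "\<bar>z\<bar> \<le> r" "0 \<le> r" using component_le_norm_cart[of "y - \<mu>" i] by (auto simp: r_def z_def)
  have "\<bar>2 * h * z - h\<^sup>2\<bar> \<le> h * (2 * \<bar>z\<bar> + h)"
    using h by (auto simp: abs_if algebra_simps power2_eq_square)
  also have "\<dots> \<le> h * (2 * (r + 1))" using r h by (intro mult_left_mono) auto
  finally have t: "\<bar>t\<bar> \<le> h * ((r + 1) / \<sigma>\<^sup>2)"
    using \<sigma> by (simp add: t_def field_simps)
  also have "\<dots> \<le> 1 * ((r + 1) / \<sigma>\<^sup>2)" using h r by (intro mult_right_mono) auto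
  finally have t1: "\<bar>t\<bar> \<le> (r + 1) / \<sigma>\<^sup>2" by simp
  have "\<bar>(exp t - 1) / h\<bar> \<le> (\<bar>t\<bar> / h) * exp \<bar>t\<bar>"
    using abs_exp_diff_one_le[of t] h by (simp add: divide_right_mono)
  also have "\<dots> \<le> ((r + 1) / \<sigma>\<^sup>2) * exp ((r + 1) / \<sigma>\<^sup>2)"
    using t t1 h r by (intro mult_mono) (auto simp: field_simps)
  also have "\<dots> \<le> (exp r / \<sigma>\<^sup>2) * exp ((r + 1) / \<sigma>\<^sup>2)"
    using exp_ge_add_one_self[of r] by (intro mult_right_mono divide_right_mono) (auto simp: add.commute)
  also have "\<dots> = exp (1 / \<sigma>\<^sup>2) / \<sigma>\<^sup>2 * exp ((1 + 1 / \<sigma>\<^sup>2) * r)"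
    by (simp add: ring_distribs exp_add add_divide_distrib)
  finally show ?thesis by (simp add: t_def r_def z_def)
qed

lemma gauss_quotient_tendsto:
  assumes "0 < (\<sigma>::real)"
  shows "((\<lambda>h. (exp ((2 * h * z - h\<^sup>2) / (2 * \<sigma>\<^sup>2)) - 1) / h) \<longlongrightarrow> z / \<sigma>\<^sup>2) (at_right 0)"
proof -
  have "((\<lambda>h. exp ((2 * h * z - h\<^sup>2) / (2 * \<sigma>\<^sup>2))) has_field_derivative z / \<sigma>\<^sup>2) (at 0)"
    using assms by (auto intro!: derivative_eq_intros simp: field_simps eval_nat_numeral)
  then have "((\<lambda>h. (exp ((2 * h * z - h\<^sup>2) / (2 * \<sigma>\<^sup>2)) - 1) / h) \<longlongrightarrow> z / \<sigma>\<^sup>2) (at 0)"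
    by (simp add: has_field_derivative_iff)
  then show ?thesis by (rule filterlim_mono) (auto simp: at_le)
qed

text \<open>
  Discrete integration by parts: by translation invariance of Lebesgue measure, the difference
  quotient passes from \<open>f\<close> to the density.
\<close>

lemma gauss_difference_quotient:
  fixes f :: "real^'n \<Rightarrow> real"
  assumes \<sigma>: "0 < \<sigma>" and h: "0 < h"
    and lip: "\<And>x y. \<bar>f x - f y\<bar> \<le> C * norm (x - y)"
    and [measurable]: "f \<in> borel_measurable borel"
  shows "(LINT y|lborel. gauss \<mu> \<sigma> y * ((f (y + h *\<^sub>R axis i 1) - f y) / h)) =
    (LINT y|lborel. gauss \<mu> \<sigma> y *
      ((exp ((2 * h * (y - \<mu>) $ i - h\<^sup>2) / (2 * \<sigma>\<^sup>2)) - 1) / h * f y))"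
proof -
  let ?e = "h *\<^sub>R axis i 1 :: real^'n"
  let ?E = "\<lambda>y. exp ((2 * h * (y - \<mu>) $ i - h\<^sup>2) / (2 * \<sigma>\<^sup>2))"
  have int: "integrable lborel (\<lambda>y. gauss \<mu> \<sigma> y * f y)"
    by (rule integrable_gauss_exp_bound[OF \<sigma>, where a = 1 and C = "\<bar>f \<mu>\<bar> + \<bar>C\<bar>"])
      (auto intro: lipschitz_exp_bound[OF lip])
  have lip': "\<bar>f (x + ?e) - f (y + ?e)\<bar> \<le> C * norm (x - y)" for x y
    using lip[of "x + ?e" "y + ?e"] by simp
  have int': "integrable lborel (\<lambda>y. gauss \<mu> \<sigma> y * f (y + ?e))"
    by (rule integrable_gauss_exp_bound[OF \<sigma>, where a = 1 and C = "\<bar>f (\<mu> + ?e)\<bar> + \<bar>C\<bar>"])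
      (auto intro: lipschitz_exp_bound[of "\<lambda>y. f (y + ?e)", OF lip'])
  have shift: "gauss \<mu> \<sigma> y * ?E y * f y = gauss \<mu> \<sigma> (y - ?e) * f (y - ?e + ?e)" for y
    by (simp add: gauss_shift[OF \<sigma>])
  have T: "lborel = distr lborel borel ((+) ?e)" by (rule lborel_distr_plus[symmetric])
  have int'': "integrable lborel (\<lambda>y. gauss \<mu> \<sigma> y * ?E y * f y)"
    unfolding shift by (subst T, subst integrable_distr_eq) (use int' in \<open>auto simp: add.commute\<close>)
  have eq: "(LINT y|lborel. gauss \<mu> \<sigma> y * ?E y * f y) = (LINT y|lborel. gauss \<mu> \<sigma> y * f (y + ?e))"
    unfolding shift by (subst T, subst integral_distr) (auto simp: add.commute)
  have "(LINT y|lborel. gauss \<mu> \<sigma> y * ((f (y + ?e) - f y) / h)) =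
      (LINT y|lborel. (gauss \<mu> \<sigma> y * f (y + ?e) - gauss \<mu> \<sigma> y * f y) / h)"
    by (intro Bochner_Integration.integral_cong) (auto simp: algebra_simps diff_divide_distrib)
  also have "\<dots> = (LINT y|lborel. (gauss \<mu> \<sigma> y * ?E y * f y - gauss \<mu> \<sigma> y * f y) / h)"
    using int int' int'' eq by simp
  also have "\<dots> = (LINT y|lborel. gauss \<mu> \<sigma> y * ((?E y - 1) / h * f y))"
    by (intro Bochner_Integration.integral_cong) (auto simp: algebra_simps diff_divide_distrib)
  finally show ?thesis .
qed

lemma gauss_dominated_convergence:
  fixes s :: "nat \<Rightarrow> real^'n \<Rightarrow> real"
  assumes [measurable]: "\<And>n. s n \<in> borel_measurable borel" "F \<in> borel_measurable borel"
    and B: "integrable lborel (\<lambda>y. gauss \<mu> \<sigma> y * B y)" "\<And>n y. \<bar>s n y\<bar> \<le> B y"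
    and lim: "AE y in lborel. (\<lambda>n. s n y) \<longlonglongrightarrow> F y"
  shows "integrable lborel (\<lambda>y. gauss \<mu> \<sigma> y * F y)"
    and "(\<lambda>n. LINT y|lborel. gauss \<mu> \<sigma> y * s n y) \<longlonglongrightarrow> (LINT y|lborel. gauss \<mu> \<sigma> y * F y)"
proof -
  have *: "AE y in lborel. (\<lambda>n. gauss \<mu> \<sigma> y * s n y) \<longlonglongrightarrow> gauss \<mu> \<sigma> y * F y"
    using lim by (rule AE_mp) (simp add: tendsto_mult_left)
  have **: "AE y in lborel. norm (gauss \<mu> \<sigma> y * s n y) \<le> gauss \<mu> \<sigma> y * B y" for n
    by (intro AE_I2) (use B(2)[of n] in \<open>simp add: abs_mult gauss_nonneg mult_left_mono\<close>)
  show "integrable lborel (\<lambda>y. gauss \<mu> \<sigma> y * F y)"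
    by (rule integrable_dominated_convergence[OF _ _ B(1) * **]) auto
  show "(\<lambda>n. LINT y|lborel. gauss \<mu> \<sigma> y * s n y) \<longlonglongrightarrow> (LINT y|lborel. gauss \<mu> \<sigma> y * F y)"
    by (rule integral_dominated_convergence[OF _ _ B(1) * **]) auto
qed

text \<open>
  Stein's identity. In the discrete integration by parts both sides converge by dominated convergence
  as the step tends to 0 from the right: a Lipschitz function has bounded difference quotients, and
  those of the density are controlled by exponential moments. An almost everywhere derivative
  suffices, because the Lipschitz bound dominates the quotients.
\<close>

proposition gaussian_stein_identity:
  fixes f w :: "real^'n \<Rightarrow> real"
  assumes \<sigma>: "0 < \<sigma>"
    and lip: "\<And>x y. \<bar>f x - f y\<bar> \<le> C * norm (x - y)"
    and [measurable]: "f \<in> borel_measurable borel" "w \<in> borel_measurable borel"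
    and deriv: "AE y in lborel. ((\<lambda>h. (f (y + h *\<^sub>R axis i 1) - f y) / h) \<longlongrightarrow> w y) (at_right 0)"
  shows "integrable lborel (\<lambda>y. gauss \<mu> \<sigma> y * w y)"
    and "integrable lborel (\<lambda>y. gauss \<mu> \<sigma> y * (f y * (y - \<mu>) $ i))"
    and "(LINT y|lborel. gauss \<mu> \<sigma> y * (f y * (y - \<mu>) $ i)) = \<sigma>\<^sup>2 * (LINT y|lborel. gauss \<mu> \<sigma> y * w y)"
proof -
  define h :: "nat \<Rightarrow> real" where "h n = inverse (real (Suc n))" for n
  have h: "0 < h n" "h n \<le> 1" for n by (auto simp: h_def inverse_le_1_iff)
  have h0: "filterlim h (at_right 0) sequentially"
    unfolding h_def filterlim_at
    using LIMSEQ_inverse_real_of_nat by (auto simp: h_def)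
  let ?E = "\<lambda>n y. (exp ((2 * h n * (y - \<mu>) $ i - (h n)\<^sup>2) / (2 * \<sigma>\<^sup>2)) - 1) / h n"
  let ?Q = "\<lambda>n y. (f (y + h n *\<^sub>R axis i 1) - f y) / h n"
  have Q_bound: "\<bar>?Q n y\<bar> \<le> C" for n y
    using lip[of "y + h n *\<^sub>R axis i 1" y] h[of n] by (simp add: field_simps)
  have Q_lim: "AE y in lborel. (\<lambda>n. ?Q n y) \<longlonglongrightarrow> w y"
    using deriv by eventually_elim (rule filterlim_compose[OF _ h0])
  have C_int: "integrable lborel (\<lambda>y. gauss \<mu> \<sigma> y * C)"
    using integrable_gauss[OF \<sigma>] by (rule integrable_mult_left)
  have Q: "integrable lborel (\<lambda>y. gauss \<mu> \<sigma> y * w y)"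
    "(\<lambda>n. LINT y|lborel. gauss \<mu> \<sigma> y * ?Q n y) \<longlonglongrightarrow> (LINT y|lborel. gauss \<mu> \<sigma> y * w y)"
    by (rule gauss_dominated_convergence[OF _ _ C_int Q_bound Q_lim]; measurable)+
  have f: "\<bar>f y\<bar> \<le> (\<bar>f \<mu>\<bar> + \<bar>C\<bar>) * exp (norm (y - \<mu>))" for y
    by (rule lipschitz_exp_bound[OF lip])
  define B where "B y = exp (1 / \<sigma>\<^sup>2) / \<sigma>\<^sup>2 * exp ((1 + 1 / \<sigma>\<^sup>2) * norm (y - \<mu>)) *
      ((\<bar>f \<mu>\<bar> + \<bar>C\<bar>) * exp (norm (y - \<mu>)))" for y
  have B: "integrable lborel (\<lambda>y. gauss \<mu> \<sigma> y * B y)"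
    by (rule integrable_gauss_exp_bound[OF \<sigma>, where a = "2 + 1 / \<sigma>\<^sup>2"
          and C = "exp (1 / \<sigma>\<^sup>2) / \<sigma>\<^sup>2 * (\<bar>f \<mu>\<bar> + \<bar>C\<bar>)"])
      (auto simp: B_def abs_mult exp_add[symmetric] algebra_simps)
  have R_bound: "\<bar>?E n y * f y\<bar> \<le> B y" for n y
    unfolding abs_mult[of "?E n y"] B_def
    by (rule mult_mono[OF gauss_quotient_bound[OF \<sigma> h] f]) auto
  have R_lim: "AE y in lborel. (\<lambda>n. ?E n y * f y) \<longlonglongrightarrow> (y - \<mu>) $ i / \<sigma>\<^sup>2 * f y"
    by (intro AE_I2 tendsto_mult_right) (rule filterlim_compose[OF gauss_quotient_tendsto[OF \<sigma>] h0])
  have R: "integrable lborel (\<lambda>y. gauss \<mu> \<sigma> y * ((y - \<mu>) $ i / \<sigma>\<^sup>2 * f y))"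
    "(\<lambda>n. LINT y|lborel. gauss \<mu> \<sigma> y * (?E n y * f y)) \<longlonglongrightarrow>
      (LINT y|lborel. gauss \<mu> \<sigma> y * ((y - \<mu>) $ i / \<sigma>\<^sup>2 * f y))"
    by (rule gauss_dominated_convergence[OF _ _ B R_bound R_lim]; measurable)+
  have quotients_eq: "(\<lambda>n. LINT y|lborel. gauss \<mu> \<sigma> y * ?Q n y) = (\<lambda>n. LINT y|lborel. gauss \<mu> \<sigma> y * (?E n y * f y))"
    by (intro ext gauss_difference_quotient[OF \<sigma> _ lip] h) auto
  have eq: "(LINT y|lborel. gauss \<mu> \<sigma> y * w y) =
      (LINT y|lborel. gauss \<mu> \<sigma> y * ((y - \<mu>) $ i / \<sigma>\<^sup>2 * f y))"
    using Q(2) R(2) unfolding quotients_eq by (rule LIMSEQ_unique)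
  have S: "gauss \<mu> \<sigma> y * (f y * (y - \<mu>) $ i) = \<sigma>\<^sup>2 * (gauss \<mu> \<sigma> y * ((y - \<mu>) $ i / \<sigma>\<^sup>2 * f y))" for y
    using \<sigma> by simp
  show "integrable lborel (\<lambda>y. gauss \<mu> \<sigma> y * w y)" by (rule Q(1))
  show "integrable lborel (\<lambda>y. gauss \<mu> \<sigma> y * (f y * (y - \<mu>) $ i))"
    unfolding S using R(1) by (intro integrable_mult_right) auto
  show "(LINT y|lborel. gauss \<mu> \<sigma> y * (f y * (y - \<mu>) $ i)) = \<sigma>\<^sup>2 * (LINT y|lborel. gauss \<mu> \<sigma> y * w y)"
    unfolding S eq by (rule integral_mult_right_zero)
qed

section \<open>Degrees of freedom\<close>

text \<open>
  The dual solution is an arbitrary selection, so the nullity need not be Borel measurable in the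
  data; it is only almost everywhere equal to a Borel function, which suffices in the completion.
\<close>

lemma borel_measurable_completion_AE_cong:
  fixes f g :: "'a \<Rightarrow> 'b::topological_space"
  assumes f: "f \<in> borel_measurable M" and eq: "AE x in M. f x = g x"
  shows "g \<in> borel_measurable (completion M)"
proof (rule measurableI)
  fix A :: "'b set" assume A: "A \<in> sets borel"
  obtain N where N: "N \<in> null_sets M" "{x \<in> space M. f x \<noteq> g x} \<subseteq> N"
    using eq by (auto simp: eventually_ae_filter)
  have "(f -` A \<inter> space M) - N \<in> sets (completion M)"
    using f A N by (intro sets_completionI_sets sets.Diff measurable_sets) auto
  moreover have "(g -` A \<inter> space M) \<inter> N \<in> sets (completion M)"
    using N by (intro sets_completionI_sub) auto
  moreover have "g -` A \<inter> space (completion M) = ((f -` A \<inter> space M) - N) \<union> ((g -` A \<inter> space M) \<inter> N)"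
    using N by auto
  ultimately show "g -` A \<inter> space (completion M) \<in> sets (completion M)"
    by (simp only: sets.Un)
qed simp

theorem theorem2:
  fixes M :: "'w measure"
    and Y :: "'w \<Rightarrow> real^'n"
    and \<mu> :: "real^'n" and \<sigma> l :: real
    and X :: "real^'p^'n" and D :: "real^'p^'m"
    and bhat :: "real^'n \<Rightarrow> real^'p" and uhat :: "real^'n \<Rightarrow> real^'m"
  assumes "rank X = CARD('p)"
    and "prob_space M"
    and "\<sigma> > 0"
    and "isotropic_gaussian M Y \<mu> \<sigma>"
    and "l \<ge> 0"
    and "\<And>y. genlasso_solution X D l y (bhat y)"
    and "\<And>y. dual_solution X D l y (uhat y)"
  shows "has_degrees_of_freedom M Y (\<lambda>y. X *v bhat y) \<and>
    integrable (completion M) (\<lambda>\<omega>. real (nullity_without D (boundary_set l (uhat (Y \<omega>))))) \<and>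
    degrees_of_freedom M Y \<sigma> (\<lambda>y. X *v bhat y) =
      (LINT \<omega>|completion M. real (nullity_without D (boundary_set l (uhat (Y \<omega>))))) \<and>
    (AE y in lborel. \<forall>u u'. dual_solution X D l y u \<longrightarrow> dual_solution X D l y u' \<longrightarrow>
      null_space_without D (boundary_set l u) = null_space_without D (boundary_set l u'))"
proof -
  note rank = assms(1) and \<sigma> = assms(3)
  interpret prob_space M by fact
  define g where "g y = X *v bhat y" for y
  let ?\<A> = "fit_pieces X D l"
  have kkt: "kkt_pair X D l y (bhat y) u" if "dual_solution X D l y u" for y u
    using solutions_kkt assms that by blast
  have piece: "g y = fit_piece X D l (boundary_set l u) {i. u $ i = l} y"
    if "dual_solution X D l y u" for y u
    unfolding g_def using fit_eq_fit_piece[OF rank kkt[OF that]] .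
  have piece_in: "fit_piece X D l B S \<in> ?\<A>" for B S
    by (auto simp: fit_pieces_def)
  have nonexp: "norm (g y - g z) \<le> norm (y - z)" for y z
    unfolding g_def using kkt_fit_nonexpansive kkt assms(7) by blast
  have lip: "\<bar>g y $ i - g z $ i\<bar> \<le> 1 * norm (y - z)" for y z i
    using nonexp[of y z] component_le_norm_cart[of "g y - g z" i] by simp
  have g_cont: "continuous_on UNIV g"
    unfolding continuous_on_iff dist_norm using nonexp by (meson le_less_trans)
  then have g_meas [measurable]: "g \<in> borel_measurable borel"
    by (rule borel_measurable_continuous_onI)
  have pieces_cont: "continuous_on UNIV A" if "A \<in> ?\<A>" for A
    using continuous_on_affine linear_fit_pieces that by blast
  have generic: "AE y in lborel. y \<notin> tie_set ?\<A>"
    by (intro AE_not_in tie_set_null finite_fit_pieces linear_fit_pieces)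
  have sel: "\<exists>A\<in>?\<A>. g z = A z" for z
    using piece[OF assms(7)] piece_in by blast

  (* A Borel version of the i-th partial derivative of the i-th coordinate of the fit. Off the tie set
     exactly one piece agrees with the fit, so that the sum has a single nonzero indicator. *)
  define w where "w i y = (\<Sum>A\<in>?\<A>. (A (axis i 1) - A 0) $ i * indicator {z. g z = A z} y)"
    for i y
  have w_meas [measurable]: "w i \<in> borel_measurable borel" for i
  proof -
    have "{z. g z = A z} \<in> sets borel" if "A \<in> ?\<A>" for A
    proof -
      have [measurable]: "A \<in> borel_measurable borel"
        using pieces_cont[OF that] by (rule borel_measurable_continuous_onI)
      show ?thesis by measurable
    qed
    then show ?thesis
      unfolding w_def by (intro borel_measurable_sum borel_measurable_times borel_measurable_const
          borel_measurable_indicator)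
  qed
  have w_eq: "w i y = (A (axis i 1) - A 0) $ i"
    if y: "y \<notin> tie_set ?\<A>" and A: "A \<in> ?\<A>" "g y = A y" for i y A
  proof -
    have "w i y = (\<Sum>A'\<in>?\<A>. if A' = A then (A (axis i 1) - A 0) $ i else 0)"
      unfolding w_def using y A by (intro sum.cong) (auto simp: tie_set_def indicator_def)
    then show ?thesis using A finite_fit_pieces[of X D l] by simp
  qed
  have deriv: "((\<lambda>h. (g (y + h *\<^sub>R axis i 1) $ i - g y $ i) / h) \<longlongrightarrow> w i y) (at_right 0)"
    if y: "y \<notin> tie_set ?\<A>" for i y
  proof -
    obtain A where A: "A \<in> ?\<A>" "g y = A y" using sel by blast
    have ev: "eventually (\<lambda>z. g z = A z) (nhds y)"
      by (rule eventually_eq_piece[OF finite_fit_pieces pieces_cont g_cont sel y A])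
    have "((\<lambda>h. y + h *\<^sub>R axis i 1) \<longlongrightarrow> y + 0 *\<^sub>R axis i 1) (at_right 0)"
      by (intro tendsto_intros)
    then have "filterlim (\<lambda>h. y + h *\<^sub>R axis i 1) (nhds y) (at_right 0)" by simp
    from eventually_compose_filterlim[OF ev this]
    have "eventually (\<lambda>h. g (y + h *\<^sub>R axis i 1) = A (y + h *\<^sub>R axis i 1)) (at_right 0)" .
    then have "eventually (\<lambda>h. (g (y + h *\<^sub>R axis i 1) $ i - g y $ i) / h = w i y) (at_right 0)"
      using eventually_at_right_less[of 0]
    proof eventually_elim
      case (elim h)
      have L: "linear (\<lambda>y. A y - A 0)" using linear_fit_pieces A by blast
      have "A (y + h *\<^sub>R axis i 1) - A y = h *\<^sub>R (A (axis i 1) - A 0)"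
        using linear_add[OF L, of y "h *\<^sub>R axis i 1"] linear_scale[OF L, of h "axis i 1"]
        by (simp add: algebra_simps)
      then have "A (y + h *\<^sub>R axis i 1) $ i - A y $ i = h * (A (axis i 1) - A 0) $ i"
        by (metis vector_minus_component vector_scaleR_component real_scaleR_def)
      with elim show ?case by (simp add: A w_eq[OF y A])
    qed
    then show ?thesis by (rule tendsto_eventually)
  qed
  have w_nullity: "(\<Sum>i\<in>UNIV. w i y) = real (nullity_without D (boundary_set l u))"
    if "y \<notin> tie_set ?\<A>" "dual_solution X D l y u" for y u
    using w_eq[OF that(1) piece_in piece[OF that(2)]] fit_piece_trace[OF rank] by simp

  (* Off the tie set the pieces of two dual solutions agree at one point, hence everywhere, and their
     common linear part determines the null space. *)
  have indep: "null_space_without D (boundary_set l u) = null_space_without D (boundary_set l u')"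
    if y: "y \<notin> tie_set ?\<A>" and u: "dual_solution X D l y u" "dual_solution X D l y u'" for y u u'
  proof -
    have "fit_piece X D l (boundary_set l u) {i. u $ i = l} =
        fit_piece X D l (boundary_set l u') {i. u' $ i = l}"
      using y piece[OF u(1)] piece[OF u(2)] piece_in unfolding tie_set_def by auto
    then have "(*v) X ` null_space_without D (boundary_set l u) =
        (*v) X ` null_space_without D (boundary_set l u')"
      by (metis image_null_space_of_fit_piece)
    moreover have "inj ((*v) X)" using rank full_rank_injective by blast
    ultimately show ?thesis by (simp add: inj_image_eq_iff)
  qed

  have dist: "distributed M lborel Y (\<lambda>x. ennreal (gauss \<mu> \<sigma> x))"
    using assms(4) by (simp add: isotropic_gaussian_def gauss_def)
  have E_int: "integrable M (\<lambda>\<omega>. f (Y \<omega>))"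
    if "integrable lborel (\<lambda>y. gauss \<mu> \<sigma> y * f y)" "f \<in> borel_measurable borel"
    for f :: "real^'n \<Rightarrow> real"
    using distributed_integrable[OF dist, of f] that by (simp add: gauss_nonneg)
  have E_eq: "(LINT \<omega>|M. f (Y \<omega>)) = (LINT y|lborel. gauss \<mu> \<sigma> y * f y)"
    if "f \<in> borel_measurable borel" for f :: "real^'n \<Rightarrow> real"
    using distributed_integral[OF dist, of f] that by (simp add: gauss_nonneg)
  have Y_meas: "Y \<in> M \<rightarrow>\<^sub>M borel"
    using distributed_measurable[OF dist] by simp

  have "(\<lambda>y. g y $ i) \<in> borel_measurable borel" for i by measurable
  note stein = gaussian_stein_identity[OF \<sigma> lip this w_meas, where \<mu> = \<mu>]
  have sg: "integrable lborel (\<lambda>y. gauss \<mu> \<sigma> y * w i y)"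
      "integrable lborel (\<lambda>y. gauss \<mu> \<sigma> y * (g y $ i * (y - \<mu>) $ i))"
      "(LINT y|lborel. gauss \<mu> \<sigma> y * (g y $ i * (y - \<mu>) $ i)) =
        \<sigma>\<^sup>2 * (LINT y|lborel. gauss \<mu> \<sigma> y * w i y)" for i
    by (rule stein; use generic deriv in \<open>auto elim!: eventually_mono\<close>)+
  (* Stein's identity for a constant function gives the mean of the Gaussian. *)
  have s1: "integrable lborel (\<lambda>y. gauss \<mu> \<sigma> y * (1 * (y - \<mu>) $ i))"
      "(LINT y|lborel. gauss \<mu> \<sigma> y * (1 * (y - \<mu>) $ i)) = \<sigma>\<^sup>2 * (LINT y|lborel. gauss \<mu> \<sigma> y * 0)" for i
    by (rule gaussian_stein_identity[OF \<sigma>, of "\<lambda>_. 1" 0 "\<lambda>_. 0"]; simp)+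
  have wY: "integrable M (\<lambda>\<omega>. w i (Y \<omega>))" for i
    by (rule E_int[OF sg(1)]) simp
  have gzY: "integrable M (\<lambda>\<omega>. g (Y \<omega>) $ i * (Y \<omega> - \<mu>) $ i)" for i
    using E_int[OF sg(2)] by simp
  have zY: "integrable M (\<lambda>\<omega>. (Y \<omega> - \<mu>) $ i)" for i
    using E_int[OF s1(1)] by simp
  have zY0: "(LINT \<omega>|M. (Y \<omega> - \<mu>) $ i) = 0" for i
    using E_eq[of "\<lambda>y. (y - \<mu>) $ i"] s1(2)[of i] by simp
  have gY: "integrable M (\<lambda>\<omega>. g (Y \<omega>) $ i)" for i
  proof (rule E_int)
    show "integrable lborel (\<lambda>y. gauss \<mu> \<sigma> y * g y $ i)"
      by (rule integrable_gauss_exp_bound[OF \<sigma>, where a = 1])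
        (use lipschitz_exp_bound[of "\<lambda>y. g y $ i", OF lip] in auto)
  qed simp
  have Y_eq: "Y \<omega> $ i = (Y \<omega> - \<mu>) $ i + \<mu> $ i" for \<omega> i by simp
  have YY: "integrable M (\<lambda>\<omega>. Y \<omega> $ i)" for i
    unfolding Y_eq by (intro Bochner_Integration.integrable_add zY) simp
  have gYY: "integrable M (\<lambda>\<omega>. g (Y \<omega>) $ i * Y \<omega> $ i)" for i
    unfolding Y_eq distrib_left
    by (intro Bochner_Integration.integrable_add gzY integrable_mult_left gY)
  have EY: "(LINT \<omega>|M. Y \<omega> $ i) = \<mu> $ i" for i
    unfolding Y_eq using zY[of i] zY0[of i] by (subst Bochner_Integration.integral_add) (auto simp: prob_space)
  have cov: "covariance M (\<lambda>\<omega>. g (Y \<omega>) $ i) (\<lambda>\<omega>. Y \<omega> $ i) = \<sigma>\<^sup>2 * (LINT \<omega>|M. w i (Y \<omega>))" for i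
  proof -
    define m where "m = (LINT \<omega>|M. g (Y \<omega>) $ i)"
    have "covariance M (\<lambda>\<omega>. g (Y \<omega>) $ i) (\<lambda>\<omega>. Y \<omega> $ i) =
        (LINT \<omega>|M. g (Y \<omega>) $ i * (Y \<omega> - \<mu>) $ i - m * (Y \<omega> - \<mu>) $ i)"
      unfolding covariance_def EY m_def by (simp add: algebra_simps)
    also have "\<dots> = (LINT \<omega>|M. g (Y \<omega>) $ i * (Y \<omega> - \<mu>) $ i) - m * (LINT \<omega>|M. (Y \<omega> - \<mu>) $ i)"
      using gzY[of i] zY[of i] by (subst Bochner_Integration.integral_diff) auto
    also have "\<dots> = \<sigma>\<^sup>2 * (LINT \<omega>|M. w i (Y \<omega>))"
      using E_eq[of "\<lambda>y. g y $ i * (y - \<mu>) $ i"] E_eq[OF w_meas] sg(3)[of i] zY0 by simp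
    finally show ?thesis .
  qed

  have "AE \<omega> in M. Y \<omega> \<notin> tie_set ?\<A>"
  proof (rule AE_distrD[OF Y_meas])
    have "AE y in density lborel (\<lambda>x. ennreal (gauss \<mu> \<sigma> x)). y \<notin> tie_set ?\<A>"
      using generic by (subst AE_density) auto
    then show "AE y in distr M borel Y. y \<notin> tie_set ?\<A>"
      using distributed_distr_eq_density[OF dist] by (metis distr_cong sets_lborel)
  qed
  then have AE_eq: "AE \<omega> in M.
      (\<Sum>i\<in>UNIV. w i (Y \<omega>)) = real (nullity_without D (boundary_set l (uhat (Y \<omega>))))"
    by eventually_elim (rule w_nullity[OF _ assms(7)])
  have W_int: "integrable M (\<lambda>\<omega>. \<Sum>i\<in>UNIV. w i (Y \<omega>))"
    by (intro Bochner_Integration.integrable_sum wY)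
  then have W_meas: "(\<lambda>\<omega>. \<Sum>i\<in>UNIV. w i (Y \<omega>)) \<in> borel_measurable M" by simp
  have W_int': "integrable (completion M) (\<lambda>\<omega>. \<Sum>i\<in>UNIV. w i (Y \<omega>))"
    using integrable_completion[OF W_meas] W_int by simp
  have N_meas: "(\<lambda>\<omega>. real (nullity_without D (boundary_set l (uhat (Y \<omega>)))))
      \<in> borel_measurable (completion M)"
    by (rule borel_measurable_completion_AE_cong[OF W_meas AE_eq])
  have N_int: "integrable (completion M) (\<lambda>\<omega>. real (nullity_without D (boundary_set l (uhat (Y \<omega>)))))"
    using integrable_cong_AE_imp[OF W_int' N_meas AE_completion[OF AE_eq]] .
  have "degrees_of_freedom M Y \<sigma> g = (\<Sum>i\<in>UNIV. (LINT \<omega>|M. w i (Y \<omega>)))"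
    using \<sigma> by (simp add: degrees_of_freedom_def cov flip: sum_distrib_left)
  also have "\<dots> = (LINT \<omega>|M. (\<Sum>i\<in>UNIV. w i (Y \<omega>)))"
    using wY by (simp add: Bochner_Integration.integral_sum)
  also have "\<dots> = (LINT \<omega>|completion M. (\<Sum>i\<in>UNIV. w i (Y \<omega>)))"
    by (rule integral_completion[OF W_meas, symmetric])
  also have "\<dots> = (LINT \<omega>|completion M. real (nullity_without D (boundary_set l (uhat (Y \<omega>)))))"
    using W_int' N_meas AE_completion[OF AE_eq] by (intro integral_cong_AE) auto
  finally have df: "degrees_of_freedom M Y \<sigma> g =
      (LINT \<omega>|completion M. real (nullity_without D (boundary_set l (uhat (Y \<omega>)))))" .
  have "has_degrees_of_freedom M Y g"
    unfolding has_degrees_of_freedom_def using gY YY gYY by blast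
  moreover have "AE y in lborel. \<forall>u u'. dual_solution X D l y u \<longrightarrow> dual_solution X D l y u' \<longrightarrow>
      null_space_without D (boundary_set l u) = null_space_without D (boundary_set l u')"
    using generic by eventually_elim (use indep in blast)
  ultimately show ?thesis
    using df N_int unfolding g_def by blast
qed

end
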